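(* Let $w(t,x)$, for $t\ge 0$ and $x>0$, be a real-valued perturbation evolving according to the linearized equation $$\frac{\partial w}{\partial t}=\frac{\partial w}{\partial x}-\frac{\partial}{\partial x}\left(\frac{1}{x}\int_0^x w(t,y)\,dy\right).$$ If the perturbation $w(0,x)$ is compactly supported and has mean value $0$ (i.e. $\int_0^\infty w(0,x)\,dx=0$), then the linearized evolution is an $L^2$-contraction, i.e. $$\frac{\partial}{\partial t}\Big|_{t=0}\int_0^\infty w(t,x)^2\,dx\le 0 .$$
   Context: The equation for $w$ is the linearization of the nonlocal transport equation $$\frac{\partial\psi}{\partial t}=\frac{\partial}{\partial x}\left(\left(\frac1x\int_0^x\psi(t,y)\,dy\right)^{-1}\psi(t,x)\right),\qquad x>0,$$ around the constant function $1$: one writes $\psi(t,x)=1+w(t,x)$ with $\|w(t,x)\|_{L^\infty}\ll 1$ and discards the lower-order terms (those of higher order in $w$). The nonlocal equation is a conjectured mean-field model in which $\psi(t,x)$ describes the density of roots at distance $x$ from the origin after differentiating $t\cdot n$ times a polynomial of degree $n$ with radially distributed roots. It has, properly interpreted, the explicit solution $\psi(t,x)=\chi_{0\le x\le 1-t}$, where $\chi$ denotes an indicator function; this solution corresponds to random Taylor polynomials $\sum_{k=0}^n\gamma_k z^k/k!$ with independent standard complex Gaussian coefficients $\gamma_k$. The theorem expresses linear stability of this solution for small perturbations close to the origin. *)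

theory Defs
  imports "HOL-Analysis.Analysis"
begin

text \<open>
  Functions of \<open>x > 0\<close> are modelled as total functions on the reals whose values at
  \<open>x \<le> 0\<close> are irrelevant: all integrals and conditions below only involve \<open>x > 0\<close>.
\<close>

definition running_mean :: "(real \<Rightarrow> real) \<Rightarrow> real \<Rightarrow> real" where
  "running_mean f x = (1 / x) * (LINT y:{0<..x}|lborel. f y)"

text \<open>
  Classical (continuously differentiable) solutions of
  \<open>w\<^sub>t = w\<^sub>x - ((1/x) \<integral>\<^sub>0\<^sup>x w(t,y) dy)\<^sub>x\<close> on \<open>t \<ge> 0\<close>, \<open>x > 0\<close>.
  The time derivative at \<open>t = 0\<close> is one-sided. The solution is required to be bounded on bounded
  sets, hence up to the boundary \<open>x = 0\<close>. This makes the running means well defined; it also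
  cannot be dropped, since otherwise \<open>x = 0\<close> may act as a source: the zero initial datum would
  admit the solution \<open>ln (1 + t/x) - t/(x + t)\<close>, whose squared \<open>L\<^sup>2\<close>-norm is a positive multiple
  of \<open>t\<close>.
\<close>

definition linearized_solution :: "(real \<Rightarrow> real \<Rightarrow> real) \<Rightarrow> bool" where
  "linearized_solution w \<longleftrightarrow>
     continuous_on ({0..} \<times> {0<..}) (\<lambda>(t, x). w t x) \<and>
     (\<forall>T X. bounded ((\<lambda>(t, x). w t x) ` ({0..T} \<times> {0<..X}))) \<and>
     (\<exists>wt wx.
        continuous_on ({0..} \<times> {0<..}) (\<lambda>(t, x). wt t x) \<and>
        continuous_on ({0..} \<times> {0<..}) (\<lambda>(t, x). wx t x) \<and>
        (\<forall>t\<ge>0. \<forall>x>0.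
           ((\<lambda>s. w s x) has_real_derivative wt t x) (at t within {0..}) \<and>
           (w t has_real_derivative wx t x) (at x) \<and>
           (\<exists>m. (running_mean (w t) has_real_derivative m) (at x) \<and>
                wt t x = wx t x - m)))"

text \<open>
  Continuous differentiability up to the boundary point \<open>x = 0\<close>; automatic for a continuously
  differentiable function on \<open>x > 0\<close> that vanishes near \<open>0\<close>.
\<close>

definition C1_up_to_zero :: "(real \<Rightarrow> real) \<Rightarrow> bool" where
  "C1_up_to_zero f \<longleftrightarrow>
     (\<exists>g g'. (\<forall>x>0. f x = g x) \<and> continuous_on {0..} g' \<and>
             (\<forall>x\<ge>0. (g has_real_derivative g' x) (at x within {0..})))"

text \<open>The support is taken relative to \<open>[0,\<infinity>)\<close>, so it may contain the origin.\<close>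

definition compactly_supported :: "(real \<Rightarrow> real) \<Rightarrow> bool" where
  "compactly_supported f \<longleftrightarrow> compact (closure {x. x > 0 \<and> f x \<noteq> 0})"

end

theory Submission
  imports Defs
begin

text \<open>
  Write \<open>m = (1/x) \<integral>\<^sub>0\<^sup>x w dy\<close>, so that \<open>w = m + x m\<^sub>x\<close>. Integrating the equation in \<open>x\<close> shows that
  \<open>m\<close> is transported: \<open>m(t,x) = m(0,x+t)\<close>, provided that no flux enters at \<open>x = 0\<close>, which
  boundedness of \<open>w\<close> enforces. With \<open>q = \<partial>\<^sub>x m(0,\<cdot>)\<close> this gives \<open>w(t,x) = w(0,x+t) - t q(x+t)\<close>.
  The mean value condition makes \<open>m(0,\<cdot>)\<close> compactly supported, hence the squared \<open>L\<^sup>2\<close>-norm is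
  \<open>\<integral>\<^sub>t\<^sup>R (w(0,x) - t q(x))\<^sup>2 dx\<close>, and its derivative at \<open>t = 0\<close> is
  \<open>- w(0,0)\<^sup>2 - 2 \<integral> w(0,x) q(x) dx = - 2 \<integral> x q(x)\<^sup>2 dx\<close>.
\<close>

section \<open>Set integrals over bounded half-open intervals\<close>

text \<open>A bounded measurable function on a set of finite measure is integrable. The left end is
  excluded so that the case \<open>a = 0\<close> covers functions with no limit at the
  origin.\<close>

lemma set_integrable_Ioc_bounded:
  fixes f :: "real \<Rightarrow> real"
  assumes "continuous_on {a<..b} f" "\<And>x. x \<in> {a<..b} \<Longrightarrow> \<bar>f x\<bar> \<le> K"
  shows "set_integrable lborel {a<..b} f"
proof -
  have "set_borel_measurable borel {a<..b} f"
    by (rule set_measurable_continuous_on) (auto intro: assms)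
  then have m: "(\<lambda>x. indicator {a<..b} x *\<^sub>R f x) \<in> borel_measurable lborel"
    by (simp add: set_borel_measurable_def)
  have "emeasure lborel {a<..b} < \<infinity>"
    by (rule emeasure_bounded_finite) simp
  then have "integrable lborel (\<lambda>x. indicator {a<..b} x *\<^sub>R f x)"
    by (intro integrableI_bounded_set[where A="{a<..b}" and B="K"] m AE_I2)
      (auto simp: assms(2) split: split_indicator)
  then show ?thesis by (simp add: set_integrable_def)
qed

lemma abs_set_integral_Ioc_le:
  fixes f :: "real \<Rightarrow> real"
  assumes "set_integrable lborel {a<..b} f" "\<And>x. x \<in> {a<..b} \<Longrightarrow> \<bar>f x\<bar> \<le> K" "a \<le> b"
  shows "\<bar>LINT x:{a<..b}|lborel. f x\<bar> \<le> K * (b - a)"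
proof -
  have c: "set_integrable lborel {a<..b} (\<lambda>x. K)"
    by (rule set_integrable_Ioc_bounded[where K="\<bar>K\<bar>"]) auto
  have "\<bar>LINT x:{a<..b}|lborel. f x\<bar> \<le> (LINT x:{a<..b}|lborel. \<bar>f x\<bar>)"
    using set_integral_norm_bound[OF assms(1)] by simp
  also have "\<dots> \<le> (LINT x:{a<..b}|lborel. K)"
    by (rule set_integral_mono) (use assms c in \<open>auto intro: set_integrable_abs\<close>)
  also have "\<dots> = K * (b - a)"
    using assms(3) by (simp add: set_lebesgue_integral_def)
  finally show ?thesis .
qed

lemma set_integral_Ioc_split:
  fixes f :: "real \<Rightarrow> real"
  assumes "set_integrable lborel {a<..c} f" "a \<le> b" "b \<le> c"
  shows "(LINT x:{a<..c}|lborel. f x) = (LINT x:{a<..b}|lborel. f x) + (LINT x:{b<..c}|lborel. f x)"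
proof -
  have "{a<..c} = {a<..b} \<union> {b<..c}" using assms by auto
  moreover have "set_integrable lborel {a<..b} f" "set_integrable lborel {b<..c} f"
    using assms by (auto intro: set_integrable_subset[OF assms(1)])
  ultimately show ?thesis by (simp add: set_integral_Un)
qed

section \<open>Running means of locally bounded continuous functions\<close>

text \<open>The regularity that every time slice of a solution has: nothing is assumed about a limit
  at 0, yet boundedness makes the integral over \<open>{0<..x}\<close> meaningful.\<close>

locale locally_bounded =
  fixes f :: "real \<Rightarrow> real"
  assumes cont: "continuous_on {0<..} f" and bdd: "\<And>X. bounded (f ` {0<..X})"
begin

lemma bound: obtains K where "K > 0" "\<And>x. 0 < x \<Longrightarrow> x \<le> X \<Longrightarrow> \<bar>f x\<bar> \<le> K"
  using bdd[of X] unfolding bounded_pos by fastforce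

lemma integrable:
  assumes "0 \<le> a"
  shows "set_integrable lborel {a<..b} f"
proof -
  obtain K where "\<And>x. 0 < x \<Longrightarrow> x \<le> b \<Longrightarrow> \<bar>f x\<bar> \<le> K" using bound by blast
  then show ?thesis using assms
    by (intro set_integrable_Ioc_bounded[where K=K] continuous_on_subset[OF cont]) auto
qed

text \<open>On a compact interval around \<open>x\<close> that avoids 0 the fundamental theorem of
  calculus applies to the Henstock-Kurzweil integral; the primitive from 0 differs from it by the
  constant integral over \<open>{0<..a}\<close>.\<close>

lemma primitive_has_derivative:
  assumes "x > 0"
  shows "((\<lambda>x. LINT y:{0<..x}|lborel. f y) has_real_derivative f x) (at x)"
proof -
  define a b where "a = x / 2" and "b = 2 * x"
  have ab: "0 < a" "a < x" "x < b" using assms by (auto simp: a_def b_def)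
  have c: "continuous_on {a..b} f" by (rule continuous_on_subset[OF cont]) (use ab in auto)
  have "((\<lambda>z. integral {a..z} f) has_real_derivative f x) (at x within {a..b})"
    by (rule integral_has_real_derivative[OF c]) (use ab in auto)
  then have "((\<lambda>z. integral {a..z} f) has_real_derivative f x) (at x)"
    using ab by (simp add: at_within_Icc_at)
  then have "((\<lambda>z. (LINT y:{0<..a}|lborel. f y) + integral {a..z} f) has_real_derivative f x) (at x)"
    by (auto intro!: derivative_eq_intros)
  moreover
  have "(LINT y:{0<..z}|lborel. f y) = (LINT y:{0<..a}|lborel. f y) + integral {a..z} f"
    if "z \<in> {a<..<b}" for z
  proof -
    have "(LINT y:{0<..z}|lborel. f y) = (LINT y:{0<..a}|lborel. f y) + (LINT y:{a<..z}|lborel. f y)"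
      by (rule set_integral_Ioc_split) (use that ab integrable in auto)
    also have "(LINT y:{a<..z}|lborel. f y) = integral {a<..z} f"
      by (rule set_borel_integral_eq_integral) (use ab integrable in auto)
    also have "\<dots> = integral {a..z} f"
      by (rule integral_subset_negligible)
        (auto intro: negligible_subset[of "{a}"])
    finally show ?thesis .
  qed
  then have "\<forall>\<^sub>F z in nhds x. (LINT y:{0<..z}|lborel. f y) = (LINT y:{0<..a}|lborel. f y) + integral {a..z} f"
    using eventually_nhds_in_open[of "{a<..<b}" x] ab by (auto elim: eventually_mono)
  ultimately show ?thesis
    by (simp add: DERIV_cong_ev[OF refl _ refl])
qed

lemma running_mean_eq: "running_mean f x = (LINT y:{0<..x}|lborel. f y) / x"
  by (simp add: running_mean_def)

lemma running_mean_has_derivative: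
  assumes "x > 0"
  shows "(running_mean f has_real_derivative (f x - running_mean f x) / x) (at x)"
  unfolding running_mean_eq[abs_def]
  using DERIV_divide[OF primitive_has_derivative[OF assms] DERIV_ident] assms
  by (simp add: diff_divide_distrib)

text \<open>The difference is the average of \<open>f - c\<close>. The case \<open>c = 0\<close>
  bounds running means uniformly; with \<open>c\<close> the value at the origin it controls them
  near 0.\<close>

lemma abs_running_mean_diff_le:
  assumes "x > 0" "\<And>y. 0 < y \<Longrightarrow> y \<le> x \<Longrightarrow> \<bar>f y - c\<bar> \<le> K"
  shows "\<bar>running_mean f x - c\<bar> \<le> K"
proof -
  have i: "set_integrable lborel {0<..x} (\<lambda>y. c)" by (rule set_integrable_Ioc_bounded) auto
  have "running_mean f x - c = (LINT y:{0<..x}|lborel. f y - c) / x"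
    using assms(1) integrable[of 0 x] i
    by (simp add: running_mean_eq set_integral_diff field_simps) (simp add: set_lebesgue_integral_def)
  moreover have "\<bar>LINT y:{0<..x}|lborel. f y - c\<bar> \<le> K * (x - 0)"
    by (rule abs_set_integral_Ioc_le) (use assms integrable[of 0 x] i in \<open>auto intro: set_integral_diff\<close>)
  ultimately have "\<bar>running_mean f x - c\<bar> \<le> K * x / x"
    using assms(1) divide_right_mono[of _ "K * x" x] by (simp add: abs_divide)
  then show ?thesis using assms(1) by simp
qed

end

section \<open>The evolution as a conservation law, and joint continuity\<close>

text \<open>Both terms on the right-hand side are merged into one spatial derivative, that of the
  flux \<open>w t x - running_mean (w t) x\<close>, so the equation can be integrated in space
  directly.\<close>

locale linearized_evolution =
  fixes w wt :: "real \<Rightarrow> real \<Rightarrow> real"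
  assumes w_cont: "continuous_on ({0..} \<times> {0<..}) (\<lambda>(t, x). w t x)"
    and w_bdd: "\<And>T X. bounded ((\<lambda>(t, x). w t x) ` ({0..T} \<times> {0<..X}))"
    and wt_cont: "continuous_on ({0..} \<times> {0<..}) (\<lambda>(t, x). wt t x)"
    and w_deriv_time: "\<And>t x. 0 \<le> t \<Longrightarrow> 0 < x \<Longrightarrow>
      ((\<lambda>s. w s x) has_real_derivative wt t x) (at t within {0..})"
    and flux_deriv: "\<And>t x. 0 \<le> t \<Longrightarrow> 0 < x \<Longrightarrow>
      ((\<lambda>x. w t x - running_mean (w t) x) has_real_derivative wt t x) (at x)"
begin

lemma uniform_bound:
  obtains K where "K > 0" "\<And>t x. 0 \<le> t \<Longrightarrow> t \<le> T \<Longrightarrow> 0 < x \<Longrightarrow> x \<le> X \<Longrightarrow> \<bar>w t x\<bar> \<le> K"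
proof -
  obtain K where "K > 0" "\<forall>v\<in>(\<lambda>(t, x). w t x) ` ({0..T} \<times> {0<..X}). norm v \<le> K"
    using w_bdd[of T X] unfolding bounded_pos by blast
  then show thesis by (intro that[of K]) auto
qed

lemma slice_time:
  fixes f :: "real \<Rightarrow> real \<Rightarrow> real"
  assumes "continuous_on ({0..} \<times> {0<..}) (\<lambda>(t, x). f t x)" "0 < x"
  shows "continuous_on {0..b} (\<lambda>s. f s x)"
  using continuous_on_compose2[OF assms(1), of "{0..b}" "\<lambda>s. (s, x)"] assms(2)
  by (force intro!: continuous_intros)

lemma locally_bounded_slice:
  assumes "0 \<le> t"
  shows "locally_bounded (w t)"
proof
  show "continuous_on {0<..} (w t)"
    using continuous_on_compose2[OF w_cont, of "{0<..}" "\<lambda>x. (t, x)"] assms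
    by (force intro!: continuous_intros)
  show "bounded (w t ` {0<..X})" for X
    by (rule bounded_subset[OF w_bdd[of t X]]) (use assms in force)
qed

lemma abs_running_mean_le:
  assumes "0 \<le> t" "0 < x" "\<And>y. 0 < y \<Longrightarrow> y \<le> x \<Longrightarrow> \<bar>w t y\<bar> \<le> K"
  shows "\<bar>running_mean (w t) x\<bar> \<le> K"
  using locally_bounded.abs_running_mean_diff_le[OF locally_bounded_slice[OF assms(1)] assms(2), of 0 K]
    assms(3) by simp

text \<open>Dominated convergence along a sequence \<open>(s n, y n)\<close>: convergent sequences
  stay in some \<open>{0..T}\<close> and \<open>{0<..X}\<close>, where a single constant bounds
  \<open>w\<close>. Continuity of the running mean and of the flux follows, as needed to
  differentiate under time integrals.\<close>

lemma primitive_continuous: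
  "continuous_on ({0..} \<times> {0<..}) (\<lambda>(t, x). LINT y:{0<..x}|lborel. w t y)"
  unfolding continuous_on_sequentially
proof (intro allI ballI impI, elim conjE)
  fix z :: "nat \<Rightarrow> real \<times> real" and a :: "real \<times> real"
  assume aS: "a \<in> {0..} \<times> {0<..}" and zS: "\<forall>n. z n \<in> {0..} \<times> {0<..}" and lim: "z \<longlonglongrightarrow> a"
  obtain t x where a: "a = (t, x)" by (cases a)
  define s where "s n = fst (z n)" for n
  define y where "y n = snd (z n)" for n
  have sl: "s \<longlonglongrightarrow> t" and yl: "y \<longlonglongrightarrow> x"
    using tendsto_fst[OF lim] tendsto_snd[OF lim] by (auto simp: a s_def[abs_def] y_def[abs_def])
  have pos: "0 \<le> t" "0 < x" "0 \<le> s n" "0 < y n" for n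
    using aS zS[rule_format, of n] by (auto simp: a s_def y_def mem_Times_iff)
  obtain T where T: "\<And>n. \<bar>s n\<bar> \<le> T"
    using convergent_imp_bounded[OF sl] by (auto simp: bounded_iff)
  obtain X where X: "\<And>n. \<bar>y n\<bar> \<le> X"
    using convergent_imp_bounded[OF yl] by (auto simp: bounded_iff)
  obtain K where "K > 0" and K: "\<And>t x. 0 \<le> t \<Longrightarrow> t \<le> T \<Longrightarrow> 0 < x \<Longrightarrow> x \<le> X \<Longrightarrow> \<bar>w t x\<bar> \<le> K"
    using uniform_bound by blast
  have meas: "set_integrable lborel {0<..b} (w r)" if "0 \<le> r" for b r
    by (rule locally_bounded.integrable[OF locally_bounded_slice[OF that]]) simp
  have "(\<lambda>n. \<integral>v. indicator {0<..y n} v *\<^sub>R w (s n) v \<partial>lborel)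
      \<longlonglongrightarrow> (\<integral>v. indicator {0<..x} v *\<^sub>R w t v \<partial>lborel)"
  proof (rule integral_dominated_convergence[where w="\<lambda>v. indicator {0<..X} v *\<^sub>R K"])
    show "(\<lambda>v. indicator {0<..x} v *\<^sub>R w t v) \<in> borel_measurable lborel"
      using meas[OF pos(1), of x] by (auto simp: set_integrable_def)
    show "(\<lambda>v. indicator {0<..y n} v *\<^sub>R w (s n) v) \<in> borel_measurable lborel" for n
      using meas[OF pos(3)[of n], of "y n"] by (auto simp: set_integrable_def)
    show "integrable lborel (\<lambda>v. indicator {0<..X} v *\<^sub>R K)"
      using set_integrable_Ioc_bounded[of 0 X "\<lambda>v. K" K] \<open>K > 0\<close> by (simp add: set_integrable_def)
    show "AE v in lborel. norm (indicator {0<..y n} v *\<^sub>R w (s n) v) \<le> indicator {0<..X} v *\<^sub>R K" for n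
    proof (intro AE_I2)
      fix v :: real
      have "s n \<le> T" "y n \<le> X" using T[of n] X[of n] by auto
      then show "norm (indicator {0<..y n} v *\<^sub>R w (s n) v) \<le> indicator {0<..X} v *\<^sub>R K"
        using K[of "s n" v] pos(3)[of n] by (auto split: split_indicator)
    qed
    \<comment> \<open>The point \<open>v = x\<close> is discarded because the indicators of
      \<open>{0<..y n}\<close> may oscillate there; elsewhere they are eventually constant.\<close>
    show "AE v in lborel. (\<lambda>n. indicator {0<..y n} v *\<^sub>R w (s n) v) \<longlonglongrightarrow> indicator {0<..x} v *\<^sub>R w t v"
      using AE_lborel_singleton[of x]
    proof eventually_elim
      fix v :: real assume "v \<noteq> x"
      consider "v \<le> 0" | "0 < v" "v < x" | "x < v" using \<open>v \<noteq> x\<close> by linarith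
      then show "(\<lambda>n. indicator {0<..y n} v *\<^sub>R w (s n) v) \<longlonglongrightarrow> indicator {0<..x} v *\<^sub>R w t v"
      proof cases
        case 1 then show ?thesis by simp
      next
        case 2
        have "((\<lambda>(t, x). w t x) \<circ> (\<lambda>n. (s n, v))) \<longlonglongrightarrow> (\<lambda>(t, x). w t x) (t, v)"
          using w_cont[unfolded continuous_on_sequentially, rule_format, of "(t, v)" "\<lambda>n. (s n, v)"]
            pos 2 tendsto_Pair[OF sl tendsto_const, of v] by auto
        then have "(\<lambda>n. w (s n) v) \<longlonglongrightarrow> w t v" by (simp add: o_def)
        moreover have "\<forall>\<^sub>F n in sequentially. w (s n) v = indicator {0<..y n} v *\<^sub>R w (s n) v"
          using order_tendstoD(1)[OF yl 2(2)] by eventually_elim (use 2 in auto)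
        ultimately show ?thesis using 2 Lim_transform_eventually by fastforce
      next
        case 3
        have "\<forall>\<^sub>F n in sequentially. indicator {0<..y n} v *\<^sub>R w (s n) v = 0"
          using order_tendstoD(2)[OF yl 3] by eventually_elim auto
        then show ?thesis using 3 by (simp add: tendsto_eventually)
      qed
    qed
  qed
  then show "((\<lambda>(t, x). LINT y:{0<..x}|lborel. w t y) \<circ> z) \<longlonglongrightarrow> (\<lambda>(t, x). LINT y:{0<..x}|lborel. w t y) a"
    by (simp add: o_def a set_lebesgue_integral_def s_def y_def case_prod_unfold)
qed

lemma running_mean_continuous:
  "continuous_on ({0..} \<times> {0<..}) (\<lambda>(t, x). running_mean (w t) x)"
  using continuous_on_divide[OF primitive_continuous continuous_on_snd[OF continuous_on_id]]
  by (simp add: running_mean_def case_prod_unfold mem_Times_iff less_imp_neq[symmetric])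

lemma flux_continuous:
  "continuous_on ({0..} \<times> {0<..}) (\<lambda>(t, x). w t x - running_mean (w t) x)"
  using continuous_on_diff[OF w_cont running_mean_continuous] by (simp add: case_prod_unfold)

section \<open>Transport of the running mean along characteristics\<close>

text \<open>
  The primitive of the equation in \<open>x\<close> leaves an unknown flux \<open>c\<close> through \<open>x = 0\<close>. If \<open>c\<close>
  were nonzero, the time integral of the bounded running mean would grow like \<open>c ln x\<close> at \<open>0\<close>.
\<close>

lemma primitive_diff_eq_integral_flux:
  assumes t: "0 \<le> t" and x: "0 < x"
  shows "(LINT y:{0<..x}|lborel. w t y) - (LINT y:{0<..x}|lborel. w 0 y)
    = integral {0..t} (\<lambda>s. w s x - running_mean (w s) x)"
proof -
  define W where "W r x = (LINT y:{0<..x}|lborel. w r y)" for r x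
  define p where "p r x = w r x - running_mean (w r) x" for r x
  have W: "(W r has_real_derivative w r x) (at x)" if "0 \<le> r" "0 < x" for r x
    unfolding W_def by (rule locally_bounded.primitive_has_derivative[OF locally_bounded_slice]; fact)
  have int: "(\<lambda>s. p s x) integrable_on cbox 0 t" "(\<lambda>s. running_mean (w s) x) integrable_on cbox 0 t"
    if "0 < x" for x
    using slice_time[OF flux_continuous that] slice_time[OF running_mean_continuous that]
    by (auto simp: p_def intro: integrable_continuous_interval)
  \<comment> \<open>Differentiation under the integral sign; by the equation the integrand becomes
    \<open>wt\<close>, whose time integral is \<open>w t x - w 0 x\<close>. This is also the
    derivative of \<open>W t - W 0\<close>, so the two sides of the claim differ by a constant
    \<open>c\<close>.\<close>
  have P: "((\<lambda>x. integral (cbox 0 t) (\<lambda>s. p s x)) has_real_derivative integral (cbox 0 t) (\<lambda>s. wt s x)) (at x)"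
    if "0 < x" for x
  proof -
    have "((\<lambda>x. integral (cbox 0 t) (\<lambda>s. p s x)) has_real_derivative integral (cbox 0 t) (\<lambda>s. wt s x)) (at x within {0<..})"
    proof (rule leibniz_rule_field_derivative)
      show "((\<lambda>x. p s x) has_real_derivative wt s x) (at x within {0<..})"
        if "x \<in> {0<..}" "s \<in> cbox 0 t" for x s
        unfolding p_def by (rule has_field_derivative_at_within[OF flux_deriv]) (use that in auto)
      show "continuous_on ({0<..} \<times> cbox 0 t) (\<lambda>(x, s). wt s x)"
        by (rule continuous_on_swap_args[OF continuous_on_subset[OF wt_cont]]) auto
    qed (use that int in auto)
    then show ?thesis using that by (simp add: at_within_open[OF _ open_greaterThan])
  qed
  have wt_int: "integral (cbox 0 t) (\<lambda>s. wt s x) = w t x - w 0 x" if "0 < x" for x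
  proof -
    have "((\<lambda>s. wt s x) has_integral w t x - w 0 x) {0..t}"
    proof (rule fundamental_theorem_of_calculus[OF t])
      fix s assume "s \<in> {0..t}"
      then have "((\<lambda>s. w s x) has_real_derivative wt s x) (at s within {0..t})"
        by (intro DERIV_subset[OF w_deriv_time]) (use that in auto)
      then show "((\<lambda>s. w s x) has_vector_derivative wt s x) (at s within {0..t})"
        by (simp add: has_real_derivative_iff_has_vector_derivative)
    qed
    then show ?thesis by (simp add: integral_unique)
  qed
  have "\<exists>c. \<forall>x\<in>{0<..}. W t x - W 0 x - integral (cbox 0 t) (\<lambda>s. p s x) = c"
  proof (rule has_field_derivative_zero_constant)
    fix x :: real assume "x \<in> {0<..}"
    then have "0 < x" by simp
    have "((\<lambda>x. W t x - W 0 x - integral (cbox 0 t) (\<lambda>s. p s x)) has_real_derivative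
        w t x - w 0 x - integral (cbox 0 t) (\<lambda>s. wt s x)) (at x)"
      by (intro DERIV_diff W P \<open>0 < x\<close> t order_refl)
    then show "((\<lambda>x. W t x - W 0 x - integral (cbox 0 t) (\<lambda>s. p s x)) has_real_derivative 0)
        (at x within {0<..})"
      unfolding wt_int[OF \<open>0 < x\<close>] diff_self by (rule has_field_derivative_at_within)
  qed simp
  then obtain c where "\<forall>x\<in>{0<..}. W t x - W 0 x - integral (cbox 0 t) (\<lambda>s. p s x) = c" ..
  from bspec[OF this] have c: "integral (cbox 0 t) (\<lambda>s. p s x) = W t x - W 0 x - c" if "0 < x" for x
    using that by (force simp: algebra_simps)
  define M where "M x = integral (cbox 0 t) (\<lambda>s. running_mean (w s) x)" for x
  \<comment> \<open>The spatial derivative of the running mean is \<open>p s x / x\<close>. Dividing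
    the identity for the integrated flux by \<open>x\<close> therefore exposes \<open>c\<close> as
    the singular term \<open>c / x\<close>.\<close>
  have M: "(M has_real_derivative running_mean (w t) x - running_mean (w 0) x - c / x) (at x)" if "0 < x" for x
  proof -
    have "(M has_real_derivative integral (cbox 0 t) (\<lambda>s. p s x / x)) (at x within {0<..})"
      unfolding M_def
    proof (rule leibniz_rule_field_derivative)
      show "((\<lambda>x. running_mean (w s) x) has_real_derivative p s x / x) (at x within {0<..})"
        if "x \<in> {0<..}" "s \<in> cbox 0 t" for x s
        unfolding p_def
        by (rule has_field_derivative_at_within[OF
              locally_bounded.running_mean_has_derivative[OF locally_bounded_slice]])
          (use that in auto)
      have "continuous_on ({0<..} \<times> cbox 0 t) (\<lambda>(x, s). p s x)"
        unfolding p_def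
        by (rule continuous_on_swap_args[OF continuous_on_subset[OF flux_continuous]]) auto
      then show "continuous_on ({0<..} \<times> cbox 0 t) (\<lambda>(x, s). p s x / x)"
        unfolding case_prod_unfold
        by (rule continuous_on_divide[OF _ continuous_on_fst[OF continuous_on_id]]) auto
    qed (use that int in auto)
    moreover have "integral (cbox 0 t) (\<lambda>s. p s x / x) = running_mean (w t) x - running_mean (w 0) x - c / x"
      using c[OF that] that by (simp add: running_mean_def W_def diff_divide_distrib)
    ultimately show ?thesis using that by (simp add: at_within_open[OF _ open_greaterThan])
  qed
  obtain K where "K > 0" and K: "\<And>s x. 0 \<le> s \<Longrightarrow> s \<le> t \<Longrightarrow> 0 < x \<Longrightarrow> x \<le> 1 \<Longrightarrow> \<bar>w s x\<bar> \<le> K"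
    using uniform_bound by blast
  have mK: "\<bar>running_mean (w s) x\<bar> \<le> K" if "0 \<le> s" "s \<le> t" "0 < x" "x \<le> 1" for s x
    by (rule abs_running_mean_le) (use that K in auto)
  have MK: "\<bar>M x\<bar> \<le> K * t" if "0 < x" "x \<le> 1" for x
    using has_integral_bound[of K "\<lambda>s. running_mean (w s) x" "M x" 0 t]
      integrable_integral[OF int(2)[OF that(1)]] mK that \<open>K > 0\<close> t by (auto simp: M_def)
  have log_bound: "\<bar>c * ln x\<bar> \<le> 2 * K * t + 2 * K" if x: "0 < x" "x \<le> 1" for x
  proof -
    \<comment> \<open>Adding \<open>c * ln x\<close> cancels the singular term: the derivative of
      \<open>N\<close> is a difference of two running means, hence at most \<open>2 * K\<close> in
      modulus. As \<open>M\<close> is bounded too, so is \<open>c * ln x\<close>.\<close>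
    define N where "N x = M x + c * ln x" for x
    have "norm (N 1 - N x) \<le> (2 * K) * norm (1 - x)"
    proof (rule field_differentiable_bound[where S="{x..1}"])
      show "(N has_field_derivative running_mean (w t) z - running_mean (w 0) z) (at z within {x..1})"
        if "z \<in> {x..1}" for z
      proof -
        have "0 < z" using that x by simp
        then have "(N has_real_derivative
            running_mean (w t) z - running_mean (w 0) z - c / z + c * (1 / z)) (at z)"
          unfolding N_def by (intro DERIV_add DERIV_cmult M DERIV_ln_divide)
        from has_field_derivative_at_within[OF this] show ?thesis by simp
      qed
      show "norm (running_mean (w t) z - running_mean (w 0) z) \<le> 2 * K" if "z \<in> {x..1}" for z
        using mK[of t z] mK[of 0 z] that x t by auto
    qed (use x in auto)
    also have "\<dots> \<le> 2 * K * 1" using \<open>K > 0\<close> x by (intro mult_left_mono) auto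
    finally show ?thesis using MK[OF x] MK[of 1] by (simp add: N_def)
  qed
  have "c = 0"
  proof (rule ccontr)
    assume "c \<noteq> 0"
    define B where "B = 2 * K * t + 2 * K"
    have "B \<ge> 0" using \<open>K > 0\<close> t by (simp add: B_def)
    \<comment> \<open>At this point of \<open>{0<..1}\<close> the modulus of \<open>c * ln x\<close>
      is exactly \<open>B + 1\<close>, which exceeds its bound \<open>B\<close>.\<close>
    have "exp (- (B + 1) / \<bar>c\<bar>) \<le> 1" using \<open>B \<ge> 0\<close> by simp
    from log_bound[OF _ this] have "\<bar>c\<bar> * \<bar>(B + 1) / \<bar>c\<bar>\<bar> \<le> B"
      by (simp only: B_def abs_mult ln_exp minus_divide_left[symmetric] abs_minus exp_gt_zero)
    then show False using \<open>c \<noteq> 0\<close> \<open>B \<ge> 0\<close> by simp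
  qed
  then have "integral {0..t} (\<lambda>s. p s x) = W t x - W 0 x" using c[OF x] by simp
  then show ?thesis unfolding W_def p_def by (rule sym)
qed

lemma primitive_has_derivative_time:
  assumes "0 \<le> t" "0 < x"
  shows "((\<lambda>s. LINT y:{0<..x}|lborel. w s y) has_real_derivative w t x - running_mean (w t) x)
    (at t within {0..})"
proof -
  have "((\<lambda>r. integral {0..r} (\<lambda>s. w s x - running_mean (w s) x)) has_real_derivative
      w t x - running_mean (w t) x) (at t within {0..t+1})"
    by (rule integral_has_real_derivative[OF slice_time[OF flux_continuous]]) (use assms in auto)
  \<comment> \<open>Integrating up to \<open>t + 1\<close> keeps \<open>t\<close> away from the
    right end, so the derivative is one-sided only at \<open>t = 0\<close>.\<close>
  moreover have "at t within {0..t+1} = at t within {0..}"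
    by (rule at_within_nhd[where S="{..<t+1}"]) auto
  ultimately have "((\<lambda>r. (LINT y:{0<..x}|lborel. w 0 y) +
      integral {0..r} (\<lambda>s. w s x - running_mean (w s) x)) has_real_derivative
      w t x - running_mean (w t) x) (at t within {0..})"
    by (auto intro!: derivative_eq_intros)
  moreover have "(LINT y:{0<..x}|lborel. w 0 y) + integral {0..r} (\<lambda>s. w s x - running_mean (w s) x)
      = (LINT y:{0<..x}|lborel. w r y)" if "r \<in> {0..}" for r
    unfolding primitive_diff_eq_integral_flux[OF _ assms(2), symmetric, OF that[unfolded atLeast_iff]] by simp
  ultimately show ?thesis
    using assms(1) has_field_derivative_transform_within[of _ _ t "{0..}" 1] by fastforce
qed

text \<open>Along the line \<open>s + x = a\<close> the primitive has derivative (flux) - (density)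
  = \<open>- running_mean (w s) (a - s)\<close>. By the quotient rule,
  \<open>W s (a - s) / (a - s)\<close> then has derivative 0.\<close>

lemma running_mean_transport:
  assumes "0 \<le> t" "0 < x"
  shows "running_mean (w t) x = running_mean (w 0) (x + t)"
proof -
  define W where "W = (\<lambda>r x. LINT y:{0<..x}|lborel. w r y)"
  define a where "a = x + t"
  have "((\<lambda>s. W s (a - s) / (a - s)) has_real_derivative 0) (at s within {0..t})" if s: "s \<in> {0..t}" for s
  proof -
    have pos: "0 \<le> s" "0 < a - s" using s assms by (auto simp: a_def)
    \<comment> \<open>Joint differentiability from the partials: the spatial partial
      \<open>w\<close> is the jointly continuous one, while the time partial is supplied at the
      point itself.\<close>
    have "((\<lambda>(s, x). W s x) has_derivative
        (\<lambda>(ds, dx). (w s (a - s) - running_mean (w s) (a - s)) * ds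
          + blinfun_apply (blinfun_mult_right (w s (a - s))) dx))
        (at (s, a - s) within {0..} \<times> {0<..})"
    proof (rule has_derivative_partialsI[where fy="\<lambda>s x. blinfun_mult_right (w s x)"])
      show "((\<lambda>s'. W s' (a - s)) has_derivative (*) (w s (a - s) - running_mean (w s) (a - s))) (at s within {0..})"
        using primitive_has_derivative_time[OF pos] by (simp add: has_field_derivative_def W_def)
      show "(W r has_derivative blinfun_apply (blinfun_mult_right (w r z))) (at z within {0<..})"
        if "r \<in> {0..}" "z \<in> {0<..}" for r z
        using locally_bounded.primitive_has_derivative[OF locally_bounded_slice, of r z] that
        by (auto simp: W_def has_field_derivative_def blinfun_mult_right.rep_eq intro: has_derivative_at_withinI)
      have "continuous_on ({0..} \<times> {0<..}) (\<lambda>(s, x). blinfun_mult_right (w s x))"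
        using bounded_linear.continuous_on[OF bounded_linear_blinfun_mult_right w_cont]
        by (simp add: case_prod_unfold)
      then show "continuous (at (s, a - s) within {0..} \<times> {0<..}) (\<lambda>(s, x). blinfun_mult_right (w s x))"
        using pos by (auto simp: continuous_on_eq_continuous_within)
    qed (use pos in auto)
    then have outer: "((\<lambda>(s, x). W s x) has_derivative
        (\<lambda>(ds, dx). (w s (a - s) - running_mean (w s) (a - s)) * ds + w s (a - s) * dx))
        (at (s, a - s) within (\<lambda>s. (s, a - s)) ` {0..t})"
      unfolding blinfun_mult_right.rep_eq
      by (rule has_derivative_subset) (use assms in \<open>auto simp: a_def\<close>)
    have "((\<lambda>s. (s, a - s)) has_derivative (\<lambda>h. (h, - h))) (at s within {0..t})"
      by (auto intro!: derivative_eq_intros)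
    from has_derivative_in_compose[OF this outer]
    have "((\<lambda>s. W s (a - s)) has_derivative
        (\<lambda>h. (w s (a - s) - running_mean (w s) (a - s)) * h + w s (a - s) * (- h))) (at s within {0..t})"
      by simp
    moreover have "(\<lambda>h. (w s (a - s) - running_mean (w s) (a - s)) * h + w s (a - s) * (- h))
        = (*) (- running_mean (w s) (a - s))"
      by (simp add: fun_eq_iff algebra_simps)
    ultimately have "((\<lambda>s. W s (a - s)) has_real_derivative - running_mean (w s) (a - s)) (at s within {0..t})"
      unfolding has_field_derivative_def by metis
    moreover have "((\<lambda>s. a - s) has_real_derivative - 1) (at s within {0..t})"
      by (auto intro!: derivative_eq_intros)
    ultimately have "((\<lambda>s. W s (a - s) / (a - s)) has_real_derivative
        (- running_mean (w s) (a - s) * (a - s) - W s (a - s) * - 1) / ((a - s) * (a - s))) (at s within {0..t})"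
      by (rule DERIV_divide) (use pos in simp)
    then show ?thesis using pos by (simp add: running_mean_def W_def)
  qed
  then have "\<exists>c. \<forall>s\<in>{0..t}. W s (a - s) / (a - s) = c"
    by (intro has_field_derivative_zero_constant) auto
  then have "W t (a - t) / (a - t) = W 0 (a - 0) / (a - 0)" using assms by force
  then show ?thesis by (simp add: a_def running_mean_def W_def)
qed

text \<open>The spatial derivative of \<open>running_mean (w t)\<close> is computed twice: by
  transport it is the initial derivative at \<open>x + t\<close>, by the quotient rule it is
  \<open>(w t x - running_mean (w t) x) / x\<close>. Equating the two and solving for
  \<open>w t x\<close> gives the formula.\<close>

lemma solution_formula:
  assumes "0 \<le> t" "0 < x"
  shows "w t x = w 0 (x + t) - t * ((w 0 (x + t) - running_mean (w 0) (x + t)) / (x + t))"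
proof -
  let ?q = "(w 0 (x + t) - running_mean (w 0) (x + t)) / (x + t)"
  have pos: "0 < x + t" using assms by simp
  have "((\<lambda>z. running_mean (w 0) (z + t)) has_real_derivative ?q) (at x)"
    using locally_bounded.running_mean_has_derivative[OF locally_bounded_slice[of 0] pos]
    by (simp add: DERIV_shift)
  moreover have "\<forall>\<^sub>F z in nhds x. running_mean (w 0) (z + t) = running_mean (w t) z"
  proof -
    have "\<forall>\<^sub>F z in nhds x. 0 < z" using order_tendstoD(1)[OF filterlim_ident assms(2)] .
    then show ?thesis by eventually_elim (rule running_mean_transport[OF assms(1), symmetric])
  qed
  ultimately have "(running_mean (w t) has_real_derivative ?q) (at x)"
    by (simp add: DERIV_cong_ev[OF refl _ refl])
  moreover have "(running_mean (w t) has_real_derivative (w t x - running_mean (w t) x) / x) (at x)"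
    by (rule locally_bounded.running_mean_has_derivative[OF locally_bounded_slice]; fact)
  ultimately have "?q = (w t x - running_mean (w 0) (x + t)) / x"
    using DERIV_unique running_mean_transport[OF assms] by metis
  then have "w t x = running_mean (w 0) (x + t) + x * ?q" using assms by (simp add: field_simps)
  also have "\<dots> = running_mean (w 0) (x + t) + (x + t) * ?q - t * ?q"
    by (simp only: distrib_right add.assoc add_diff_eq[symmetric] diff_self add_0_right)
  also have "(x + t) * ?q = w 0 (x + t) - running_mean (w 0) (x + t)" using pos by simp
  finally show ?thesis by simp
qed

end

section \<open>Products, limits at the origin and integrals over half-lines\<close>

lemma locally_bounded_mult:
  assumes "locally_bounded f" "locally_bounded g"
  shows "locally_bounded (\<lambda>x. f x * g x)"
proof
  interpret f: locally_bounded f by fact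
  interpret g: locally_bounded g by fact
  show "continuous_on {0<..} (\<lambda>x. f x * g x)"
    by (rule continuous_on_mult[OF f.cont g.cont])
  show "bounded ((\<lambda>x. f x * g x) ` {0<..X})" for X
  proof -
    obtain K where K: "K > 0" "\<And>x. 0 < x \<Longrightarrow> x \<le> X \<Longrightarrow> \<bar>f x\<bar> \<le> K" using f.bound[of X] by blast
    obtain L where L: "L > 0" "\<And>x. 0 < x \<Longrightarrow> x \<le> X \<Longrightarrow> \<bar>g x\<bar> \<le> L" using g.bound[of X] by blast
    have "\<bar>f x * g x\<bar> \<le> K * L" if "0 < x" "x \<le> X" for x
      unfolding abs_mult by (rule mult_mono) (use K L that in auto)
    then show ?thesis by (auto intro!: boundedI[where B="K * L"])
  qed
qed

context locally_bounded
begin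

lemma running_mean_tendsto:
  assumes "(f \<longlongrightarrow> c) (at_right 0)"
  shows "(running_mean f \<longlongrightarrow> c) (at_right 0)"
proof (rule tendstoI)
  fix e :: real assume "e > 0"
  then have "\<forall>\<^sub>F x in at_right 0. dist (f x) c < e / 2"
    by (intro tendstoD[OF assms]) simp
  then obtain b where b: "b > 0" "\<And>y. 0 < y \<Longrightarrow> y < b \<Longrightarrow> dist (f y) c < e / 2"
    unfolding eventually_at_right_field by auto
  have "dist (running_mean f x) c < e" if x: "0 < x" "x < b" for x
  proof -
    have "\<bar>running_mean f x - c\<bar> \<le> e / 2"
    proof (rule abs_running_mean_diff_le[OF x(1)])
      fix y assume "0 < y" "y \<le> x"
      then show "\<bar>f y - c\<bar> \<le> e / 2" using b(2)[of y] x by (simp add: dist_real_def)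
    qed
    then show ?thesis using \<open>e > 0\<close> by (simp add: dist_real_def)
  qed
  then show "\<forall>\<^sub>F x in at_right 0. dist (running_mean f x) c < e"
    unfolding eventually_at_right_field using b(1) by auto
qed

text \<open>The missing piece over \<open>{0<..t}\<close> is at most a constant times
  \<open>t\<close>. This handles the coefficients of the energy, whose lower limit moves with
  time.\<close>

lemma tail_integral_tendsto:
  assumes "0 < R"
  shows "((\<lambda>t. LINT x:{t<..R}|lborel. f x) \<longlongrightarrow> (LINT x:{0<..R}|lborel. f x)) (at_right 0)"
proof -
  obtain K where K: "K > 0" "\<And>x. 0 < x \<Longrightarrow> x \<le> R \<Longrightarrow> \<bar>f x\<bar> \<le> K" using bound[of R] by blast
  have ev: "\<forall>\<^sub>F t in at_right 0. 0 < t \<and> t < R"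
    using assms by (auto simp: eventually_at_right_field)
  have "((\<lambda>t. LINT x:{0<..t}|lborel. f x) \<longlongrightarrow> 0) (at_right 0)"
  proof (rule Lim_null_comparison)
    show "\<forall>\<^sub>F t in at_right 0. norm (LINT x:{0<..t}|lborel. f x) \<le> K * (t - 0)"
      using ev unfolding real_norm_def
    proof eventually_elim
      case (elim t)
      show ?case by (rule abs_set_integral_Ioc_le) (use elim K integrable in auto)
    qed
    have "((\<lambda>t. K * (t - 0)) \<longlongrightarrow> K * (0 - 0)) (at_right 0)"
      by (intro tendsto_intros)
    then show "((\<lambda>t. K * (t - 0)) \<longlongrightarrow> 0) (at_right 0)" by simp
  qed
  then have "((\<lambda>t. (LINT x:{0<..R}|lborel. f x) - (LINT x:{0<..t}|lborel. f x))
      \<longlongrightarrow> (LINT x:{0<..R}|lborel. f x) - 0) (at_right 0)"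
    by (intro tendsto_intros)
  moreover have "\<forall>\<^sub>F t in at_right 0. (LINT x:{0<..R}|lborel. f x) - (LINT x:{0<..t}|lborel. f x)
      = (LINT x:{t<..R}|lborel. f x)"
    using ev
  proof eventually_elim
    case (elim t)
    then show ?case using set_integral_Ioc_split[of 0 R f t] integrable[of 0 R] by simp
  qed
  ultimately show ?thesis using Lim_transform_eventually by fastforce
qed

end

lemma set_integral_Ioi_eq_Ioc:
  fixes f :: "real \<Rightarrow> real"
  assumes "\<And>x. R < x \<Longrightarrow> f x = 0"
  shows "(LINT x:{a<..}|lborel. f x) = (LINT x:{a<..R}|lborel. f x)"
    and "set_integrable lborel {a<..} f \<longleftrightarrow> set_integrable lborel {a<..R} f"
proof -
  have "(\<lambda>x. indicator {a<..} x *\<^sub>R f x) = (\<lambda>x. indicator {a<..R} x *\<^sub>R f x)"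
    using assms by (fastforce split: split_indicator)
  then show "(LINT x:{a<..}|lborel. f x) = (LINT x:{a<..R}|lborel. f x)"
    and "set_integrable lborel {a<..} f \<longleftrightarrow> set_integrable lborel {a<..R} f"
    by (simp_all only: set_lebesgue_integral_def set_integrable_def)
qed

lemma set_integral_Ioi_shift:
  fixes f :: "real \<Rightarrow> real"
  shows "(LINT x:{0<..}|lborel. f (x + t)) = (LINT x:{t<..}|lborel. f x)"
proof -
  have "(LINT x:{t<..}|lborel. f x) = (\<integral>x. indicator {t<..} (t + 1 * x) *\<^sub>R f (t + 1 * x) \<partial>lborel)"
    unfolding set_lebesgue_integral_def by (subst lborel_integral_real_affine[where c=1 and t=t]) auto
  also have "\<dots> = (LINT x:{0<..}|lborel. f (x + t))"
    unfolding set_lebesgue_integral_def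
    by (rule Bochner_Integration.integral_cong) (auto simp: add.commute split: split_indicator)
  finally show ?thesis by simp
qed

section \<open>The energy of a mean-zero datum\<close>

text \<open>\<open>g\<close> is the continuously differentiable extension of \<open>f\<close> to the
  origin, so \<open>g 0\<close> is the boundary value of the datum; values of \<open>f\<close>
  itself at or below 0 carry no information.\<close>

locale mean_zero_datum = locally_bounded +
  fixes g g' :: "real \<Rightarrow> real" and R :: real
  assumes f_eq: "\<And>x. 0 < x \<Longrightarrow> f x = g x"
    and g'_cont: "continuous_on {0..} g'"
    and g_deriv: "\<And>x. 0 \<le> x \<Longrightarrow> (g has_real_derivative g' x) (at x within {0..})"
    and R_pos: "0 < R"
    and f_eq_0: "\<And>x. R \<le> x \<Longrightarrow> f x = 0"
    and mean_zero: "(LINT x:{0<..}|lborel. f x) = 0"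
begin

text \<open>The derivative of the running mean, called q in the overview, written out by the
  quotient rule.\<close>

definition slope :: "real \<Rightarrow> real" where
  "slope x = (f x - running_mean f x) / x"

text \<open>Beyond the support the primitive equals the total integral. Here the mean value
  condition enters, and it makes \<open>slope\<close> vanish there as well.\<close>

lemma running_mean_eq_0:
  assumes "R \<le> x"
  shows "running_mean f x = 0"
  using set_integral_Ioi_eq_Ioc(1)[of x f 0] f_eq_0 assms mean_zero by (simp add: running_mean_eq)

lemma slope_eq_0: "R \<le> x \<Longrightarrow> slope x = 0"
  by (simp add: slope_def f_eq_0 running_mean_eq_0)

lemma f_tendsto: "(f \<longlongrightarrow> g 0) (at_right 0)"
proof -
  have "(g \<longlongrightarrow> g 0) (at 0 within {0..})"
    using DERIV_continuous[OF g_deriv[of 0]] by (simp add: continuous_within)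
  then have "(g \<longlongrightarrow> g 0) (at_right 0)" by (simp add: at_within_Ici_at_right)
  then show ?thesis
    by (rule Lim_transform_eventually) (auto simp: eventually_at_right_field f_eq intro: gt_ex)
qed

lemma lipschitz_at_zero:
  obtains K where "K > 0" "\<And>x. 0 < x \<Longrightarrow> x \<le> R \<Longrightarrow> \<bar>f x - g 0\<bar> \<le> K * x"
proof -
  have "compact (g' ` {0..R})"
    by (rule compact_continuous_image[OF continuous_on_subset[OF g'_cont]]) auto
  then obtain K where K: "K > 0" "\<forall>v\<in>g' ` {0..R}. norm v \<le> K"
    using compact_imp_bounded bounded_pos by metis
  have "\<bar>f x - g 0\<bar> \<le> K * x" if x: "0 < x" "x \<le> R" for x
  proof -
    have "norm (g x - g 0) \<le> K * norm (x - 0)"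
    proof (rule field_differentiable_bound[where S="{0..x}"])
      show "(g has_field_derivative g' z) (at z within {0..x})" if "z \<in> {0..x}" for z
        by (rule DERIV_subset[OF g_deriv]) (use that in auto)
      show "norm (g' z) \<le> K" if "z \<in> {0..x}" for z using K(2) that x by auto
    qed (use x in auto)
    then show ?thesis using x f_eq by simp
  qed
  then show thesis using that K(1) by blast
qed

text \<open>The factor \<open>1 / x\<close> is dangerous only near 0. There \<open>f x\<close> and
  its running mean both lie within \<open>K * x\<close> of \<open>g 0\<close>, by the Lipschitz
  bound at the origin, so the quotient is at most \<open>2 * K\<close>.\<close>

lemma slope_bound:
  obtains K where "K > 0" "\<And>x. 0 < x \<Longrightarrow> \<bar>slope x\<bar> \<le> K"
proof -
  obtain K where K: "K > 0" "\<And>x. 0 < x \<Longrightarrow> x \<le> R \<Longrightarrow> \<bar>f x - g 0\<bar> \<le> K * x"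
    using lipschitz_at_zero by blast
  have "\<bar>slope x\<bar> \<le> 2 * K" if x: "0 < x" for x
  proof (cases "x \<le> R")
    case True
    have "\<bar>running_mean f x - g 0\<bar> \<le> K * x"
    proof (rule abs_running_mean_diff_le[OF x])
      fix y assume y: "0 < y" "y \<le> x"
      then have "\<bar>f y - g 0\<bar> \<le> K * y" using K(2) True by simp
      also have "\<dots> \<le> K * x" using y K(1) by simp
      finally show "\<bar>f y - g 0\<bar> \<le> K * x" .
    qed
    then have "\<bar>f x - running_mean f x\<bar> \<le> 2 * K * x" using K(2)[OF x True] by linarith
    then have "\<bar>f x - running_mean f x\<bar> / x \<le> 2 * K * x / x" using x by (intro divide_right_mono) auto
    then show ?thesis using x by (simp add: slope_def abs_divide)
  next
    case False
    then show ?thesis using K(1) by (simp add: slope_eq_0)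
  qed
  then show thesis using that[of "2 * K"] K(1) by simp
qed

lemma running_mean_deriv_slope:
  "0 < x \<Longrightarrow> (running_mean f has_real_derivative slope x) (at x)"
  unfolding slope_def by (rule running_mean_has_derivative)

lemma running_mean_cont: "continuous_on {0<..} (running_mean f)"
  using running_mean_deriv_slope
  by (intro continuous_at_imp_continuous_on ballI) (metis DERIV_isCont greaterThan_iff)

lemma locally_bounded_slope: "locally_bounded slope"
proof
  show "continuous_on {0<..} slope"
    unfolding slope_def
    by (rule continuous_on_divide[OF continuous_on_diff[OF cont running_mean_cont] continuous_on_id]) auto
  obtain K where "K > 0" "\<And>x. 0 < x \<Longrightarrow> \<bar>slope x\<bar> \<le> K" using slope_bound by blast
  then show "bounded (slope ` {0<..X})" for X by (auto intro!: boundedI[where B=K])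
qed

text \<open>Shifting by \<open>t\<close> moves the time dependence into the lower limit, and
  expanding the square leaves a quadratic in \<open>t\<close> whose coefficients are tail
  integrals.\<close>

lemma energy_expansion:
  assumes "0 \<le> t"
  shows "(LINT x:{0<..}|lborel. (f (x + t) - t * slope (x + t))\<^sup>2)
    = (LINT x:{t<..R}|lborel. f x * f x) - 2 * t * (LINT x:{t<..R}|lborel. f x * slope x)
      + t\<^sup>2 * (LINT x:{t<..R}|lborel. slope x * slope x)"
proof -
  have lb: "locally_bounded f" by unfold_locales
  note ints = locally_bounded.integrable[OF locally_bounded_mult[OF lb lb] assms, of R]
    locally_bounded.integrable[OF locally_bounded_mult[OF lb locally_bounded_slope] assms, of R]
    locally_bounded.integrable[OF locally_bounded_mult[OF locally_bounded_slope locally_bounded_slope] assms, of R]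
  have "(LINT x:{0<..}|lborel. (f (x + t) - t * slope (x + t))\<^sup>2)
      = (LINT x:{t<..}|lborel. (f x - t * slope x)\<^sup>2)"
    by (rule set_integral_Ioi_shift)
  also have "\<dots> = (LINT x:{t<..R}|lborel. (f x - t * slope x)\<^sup>2)"
    by (rule set_integral_Ioi_eq_Ioc) (simp add: f_eq_0 slope_eq_0)
  also have "\<dots> = (LINT x:{t<..R}|lborel. (f x * f x - 2 * t * (f x * slope x)) + t\<^sup>2 * (slope x * slope x))"
    by (simp add: power2_eq_square algebra_simps)
  also have "\<dots> = (LINT x:{t<..R}|lborel. f x * f x) - 2 * t * (LINT x:{t<..R}|lborel. f x * slope x)
      + t\<^sup>2 * (LINT x:{t<..R}|lborel. slope x * slope x)"
    using ints by (simp add: set_integral_add set_integral_diff)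
  finally show ?thesis .
qed

text \<open>With \<open>m = running_mean f\<close> one has \<open>f = m + x m'\<close>, so \<open>f m' \<ge> (m\<^sup>2)' / 2\<close>.\<close>

lemma integral_f_slope_ge:
  assumes "0 < t" "t < R"
  shows "2 * (LINT x:{t<..R}|lborel. f x * slope x) \<ge> - (running_mean f t)\<^sup>2"
proof -
  \<comment> \<open>With \<open>t > 0\<close> the interval avoids the origin, so everything is
    continuous on a compact set; the limit as \<open>t\<close> tends to 0 is taken in
    \<open>energy_derivative\<close>.\<close>
  have cf: "continuous_on {t..R} (\<lambda>x. f x * slope x)"
    by (intro continuous_on_mult continuous_on_subset[OF cont]
        continuous_on_subset[OF locally_bounded.cont[OF locally_bounded_slope]]) (use assms in auto)
  have "((\<lambda>x. 2 * (running_mean f x * slope x)) has_integral (running_mean f R)\<^sup>2 - (running_mean f t)\<^sup>2) {t..R}"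
  proof (rule fundamental_theorem_of_calculus)
    fix x assume "x \<in> {t..R}"
    then have "0 < x" using assms by auto
    from DERIV_power[OF running_mean_deriv_slope[OF this], of 2]
    have "((\<lambda>x. (running_mean f x)\<^sup>2) has_real_derivative 2 * (running_mean f x * slope x)) (at x)"
      by (simp add: algebra_simps)
    from has_field_derivative_at_within[OF this]
    show "((\<lambda>x. (running_mean f x)\<^sup>2) has_vector_derivative 2 * (running_mean f x * slope x)) (at x within {t..R})"
      by (simp add: has_real_derivative_iff_has_vector_derivative)
  qed (use assms in simp)
  moreover have "((\<lambda>x. 2 * (f x * slope x)) has_integral 2 * integral {t..R} (\<lambda>x. f x * slope x)) {t..R}"
    by (intro has_integral_mult_right integrable_integral integrable_continuous_interval cf)
  moreover have "2 * (running_mean f x * slope x) \<le> 2 * (f x * slope x)" if "x \<in> {t..R}" for x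
  proof -
    have "0 < x" using that assms by simp
    then have "f x = running_mean f x + x * slope x" by (simp add: slope_def)
    then have "f x * slope x = running_mean f x * slope x + x * (slope x)\<^sup>2"
      by (simp add: power2_eq_square algebra_simps)
    then show ?thesis using \<open>0 < x\<close> by simp
  qed
  ultimately have "(running_mean f R)\<^sup>2 - (running_mean f t)\<^sup>2 \<le> 2 * integral {t..R} (\<lambda>x. f x * slope x)"
    by (rule has_integral_le)
  moreover have "(LINT x:{t<..R}|lborel. f x * slope x) = integral {t..R} (\<lambda>x. f x * slope x)"
  proof -
    have "(LINT x:{t<..R}|lborel. f x * slope x) = integral {t<..R} (\<lambda>x. f x * slope x)"
      by (rule set_borel_integral_eq_integral(2)[OF locally_bounded.integrable[OF locally_bounded_mult]])
        (use assms locally_bounded_slope in \<open>auto intro: locally_bounded_axioms\<close>)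
    also have "\<dots> = integral {t..R} (\<lambda>x. f x * slope x)"
      by (rule integral_subset_negligible) (auto intro: negligible_subset[of "{t}"])
    finally show ?thesis .
  qed
  \<comment> \<open>The boundary term at \<open>R\<close> vanishes, leaving only the one at
    \<open>t\<close>.\<close>
  ultimately show ?thesis by (simp add: running_mean_eq_0)
qed

text \<open>In the difference quotient the moving lower limit contributes minus the running mean of
  the squared datum, which tends to \<open>- (g 0)\<^sup>2\<close>; the cross term tends to
  \<open>- 2 * B 0\<close>, and the quadratic term to 0.\<close>

lemma energy_derivative:
  "\<exists>D\<le>0. ((\<lambda>t. LINT x:{0<..}|lborel. (f (x + t) - t * slope (x + t))\<^sup>2) has_real_derivative D)
    (at 0 within {0..})"
proof -
  define A B C where "A t = (LINT x:{t<..R}|lborel. f x * f x)"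
    and "B t = (LINT x:{t<..R}|lborel. f x * slope x)"
    and "C t = (LINT x:{t<..R}|lborel. slope x * slope x)" for t
  define F where "F t = (LINT x:{0<..}|lborel. (f (x + t) - t * slope (x + t))\<^sup>2)" for t
  have F: "F t = A t - 2 * t * B t + t\<^sup>2 * C t" if "0 \<le> t" for t
    unfolding F_def A_def B_def C_def by (rule energy_expansion[OF that])
  have lb: "locally_bounded (\<lambda>x. f x * f x)" "locally_bounded (\<lambda>x. f x * slope x)"
    "locally_bounded (\<lambda>x. slope x * slope x)"
    by (intro locally_bounded_mult locally_bounded_axioms locally_bounded_slope)+
  have ev: "\<forall>\<^sub>F t in at_right 0. 0 < t \<and> t < R"
    using R_pos by (auto simp: eventually_at_right_field)
  have B: "(B \<longlongrightarrow> B 0) (at_right 0)" and C: "(C \<longlongrightarrow> C 0) (at_right 0)"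
    unfolding B_def[abs_def] C_def[abs_def]
    by (rule locally_bounded.tail_integral_tendsto[OF lb(2) R_pos],
        rule locally_bounded.tail_integral_tendsto[OF lb(3) R_pos])
  have ff: "(running_mean (\<lambda>x. f x * f x) \<longlongrightarrow> g 0 * g 0) (at_right 0)"
    by (rule locally_bounded.running_mean_tendsto[OF lb(1) tendsto_mult[OF f_tendsto f_tendsto]])
  \<comment> \<open>The summand \<open>0 * C 0\<close> is kept so that \<open>D\<close> has
    literally the shape produced by the limit rules.\<close>
  define D where "D = - (g 0 * g 0) - 2 * B 0 + 0 * C 0"
  have "((\<lambda>t. - running_mean (\<lambda>x. f x * f x) t - 2 * B t + t * C t) \<longlongrightarrow> D) (at_right 0)"
    unfolding D_def by (intro tendsto_intros ff B C)
  moreover have "\<forall>\<^sub>F t in at_right 0.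
      - running_mean (\<lambda>x. f x * f x) t - 2 * B t + t * C t = (F t - F 0) / (t - 0)"
    using ev
  proof eventually_elim
    case (elim t)
    have "A 0 = t * running_mean (\<lambda>x. f x * f x) t + A t"
      unfolding A_def
      using set_integral_Ioc_split[OF locally_bounded.integrable[OF lb(1) order_refl], of t R] elim
      by (simp add: running_mean_def)
    then have "F t - F 0 = t * (- running_mean (\<lambda>x. f x * f x) t - 2 * B t + t * C t)"
      using F[of t] F[of 0] elim by (simp add: power2_eq_square algebra_simps)
    then show ?case using elim by simp
  qed
  ultimately have "((\<lambda>t. (F t - F 0) / (t - 0)) \<longlongrightarrow> D) (at 0 within {0..})"
    unfolding at_within_Ici_at_right by (rule Lim_transform_eventually)
  then have "(F has_real_derivative D) (at 0 within {0..})"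
    by (simp add: has_field_derivative_iff)
  moreover have "D \<le> 0"
  proof -
    \<comment> \<open>Limit of \<open>integral_f_slope_ge\<close>: a negative cross term is
      compensated exactly by the mass leaving through the origin.\<close>
    have "- (g 0)\<^sup>2 \<le> 2 * B 0"
    proof (rule tendsto_le[OF trivial_limit_at_right_real])
      show "((\<lambda>t. 2 * B t) \<longlongrightarrow> 2 * B 0) (at_right 0)" by (intro tendsto_intros B)
      show "((\<lambda>t. - (running_mean f t)\<^sup>2) \<longlongrightarrow> - (g 0)\<^sup>2) (at_right 0)"
        by (intro tendsto_intros running_mean_tendsto f_tendsto)
      show "\<forall>\<^sub>F t in at_right 0. - (running_mean f t)\<^sup>2 \<le> 2 * B t"
        using ev by eventually_elim (simp add: B_def integral_f_slope_ge)
    qed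
    then show ?thesis by (simp add: D_def power2_eq_square)
  qed
  ultimately show ?thesis unfolding F_def[abs_def] by blast
qed

end

section \<open>Contraction for solutions of the linearized equation\<close>

theorem mainTheorem1:
  fixes w :: "real \<Rightarrow> real \<Rightarrow> real"
  assumes "linearized_solution w"
    and "C1_up_to_zero (w 0)"
    and "compactly_supported (w 0)"
    and "(LINT x:{0<..}|lborel. w 0 x) = 0"
  shows "(\<forall>t\<ge>0. set_integrable lborel {0<..} (\<lambda>x. (w t x)\<^sup>2)) \<and>
         (\<exists>D\<le>0. ((\<lambda>t. LINT x:{0<..}|lborel. (w t x)\<^sup>2) has_real_derivative D)
                 (at 0 within {0..}))"
proof -
  obtain wt wx where wt: "continuous_on ({0..} \<times> {0<..}) (\<lambda>(t, x). wt t x)"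
    and sol: "\<forall>t\<ge>0. \<forall>x>0.
           ((\<lambda>s. w s x) has_real_derivative wt t x) (at t within {0..}) \<and>
           (w t has_real_derivative wx t x) (at x) \<and>
           (\<exists>m. (running_mean (w t) has_real_derivative m) (at x) \<and> wt t x = wx t x - m)"
    using assms(1) unfolding linearized_solution_def by blast
  interpret linearized_evolution w wt
  proof
    show "continuous_on ({0..} \<times> {0<..}) (\<lambda>(t, x). w t x)"
      and "bounded ((\<lambda>(t, x). w t x) ` ({0..T} \<times> {0<..X}))" for T X
      using assms(1) unfolding linearized_solution_def by blast+
    show "((\<lambda>s. w s x) has_real_derivative wt t x) (at t within {0..})" if "0 \<le> t" "0 < x" for t x
      using sol that by blast
    show "((\<lambda>x. w t x - running_mean (w t) x) has_real_derivative wt t x) (at x)"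
      if pos: "0 \<le> t" "0 < x" for t x
    proof -
      obtain m where m: "(running_mean (w t) has_real_derivative m) (at x)" "wt t x = wx t x - m"
        and wx: "(w t has_real_derivative wx t x) (at x)"
        using sol[rule_format, OF pos] by blast
      show ?thesis unfolding m(2) by (rule DERIV_diff[OF wx m(1)])
    qed
  qed (fact wt)
  obtain g g' where g: "\<forall>x>0. w 0 x = g x" "continuous_on {0..} g'"
    "\<forall>x\<ge>0. (g has_real_derivative g' x) (at x within {0..})"
    using assms(2) unfolding C1_up_to_zero_def by blast
  have "bounded {x. 0 < x \<and> w 0 x \<noteq> 0}"
    using assms(3) unfolding compactly_supported_def
    by (rule bounded_subset[OF compact_imp_bounded closure_subset])
  then obtain R0 where R0: "0 < R0" "\<forall>x\<in>{x. 0 < x \<and> w 0 x \<noteq> 0}. norm x \<le> R0"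
    unfolding bounded_pos by blast
  \<comment> \<open>The support lies in \<open>{0<..R0}\<close>; adding 1 makes the datum vanish at
    \<open>R\<close> too, as \<open>mean_zero_datum\<close> asks.\<close>
  define R where "R = R0 + 1"
  have R_pos: "0 < R" using R0(1) by (simp add: R_def)
  have R: "w 0 x = 0" if "R \<le> x" for x
  proof -
    show "w 0 x = 0"
      using bspec[OF R0(2), of x] R0(1) that by (cases "w 0 x = 0") (auto simp: R_def)
  qed
  interpret locally_bounded "w 0" by (rule locally_bounded_slice) simp
  interpret mean_zero_datum "w 0" g g' R
    by unfold_locales (use g R R_pos assms(4) in auto)
  have w_eq: "w t x = w 0 (x + t) - t * slope (x + t)" if "0 \<le> t" "0 < x" for t x
    unfolding slope_def by (rule solution_formula[OF that])
  have "set_integrable lborel {0<..} (\<lambda>x. (w t x)\<^sup>2)" if "0 \<le> t" for t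
  proof -
    have "set_integrable lborel {0<..R} (\<lambda>x. w t x * w t x)"
      by (intro locally_bounded.integrable locally_bounded_mult locally_bounded_slice that order_refl)
    moreover have "w t x = 0" if "R < x" for x
      using w_eq[OF \<open>0 \<le> t\<close>, of x] R R_pos that \<open>0 \<le> t\<close> slope_eq_0[of "x + t"] by simp
    ultimately show ?thesis
      using set_integral_Ioi_eq_Ioc(2)[of R "\<lambda>x. (w t x)\<^sup>2" 0] by (simp add: power2_eq_square)
  qed
  moreover
  have energy: "(LINT x:{0<..}|lborel. (w t x)\<^sup>2)
      = (LINT x:{0<..}|lborel. (w 0 (x + t) - t * slope (x + t))\<^sup>2)" if "0 \<le> t" for t
    by (rule set_lebesgue_integral_cong) (use w_eq[OF that] in auto)
  obtain D where "D \<le> 0"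
    and D: "((\<lambda>t. LINT x:{0<..}|lborel. (w 0 (x + t) - t * slope (x + t))\<^sup>2) has_real_derivative D)
      (at 0 within {0..})"
    using energy_derivative by blast
  \<comment> \<open>The one-sided derivative compares values at nonnegative times only, exactly
    where the explicit energy agrees with that of \<open>w\<close>.\<close>
  have "((\<lambda>t. LINT x:{0<..}|lborel. (w t x)\<^sup>2) has_real_derivative D) (at 0 within {0..})"
    by (rule has_field_derivative_transform_within[OF D zero_less_one]) (use energy in auto)
  then have "\<exists>D\<le>0. ((\<lambda>t. LINT x:{0<..}|lborel. (w t x)\<^sup>2) has_real_derivative D) (at 0 within {0..})"
    using \<open>D \<le> 0\<close> by blast
  ultimately show ?thesis by blast
qed

end
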